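(* Let $\mathbb{K}$ be a field of characteristic $0$. Every triassociative algebra $(D,\dashv,\vdash,\perp)$ over $\mathbb{K}$ is induced by a relative averaging algebra of weight $1$: there exists a relative averaging algebra $(A,B,P)$ of weight $1$ with underlying vector space $B=D$ such that, for all $x,y\in D$, $$x\dashv y=x\cdot P(y),\qquad x\vdash y=P(x)\cdot y,\qquad x\perp y=xy,$$ where $xy$ is the product of $B$ and $\cdot$ denotes the left and right $A$-actions on $B$.
   Context: An associative $A$-bimodule is an associative algebra $B$ (product $xy$) with linear maps $A\otimes B\to B$, $(a,x)\mapsto a\cdot x$ and $B\otimes A\to B$, $(x,a)\mapsto x\cdot a$ such that for all $a,b\in A$, $x,y\in B$: $(ab)\cdot x=a\cdot(b\cdot x)$, $(a\cdot x)\cdot b=a\cdot(x\cdot b)$, $(x\cdot a)\cdot b=x\cdot(ab)$, $(xy)\cdot a=x(y\cdot a)$, $(x\cdot a)y=x(a\cdot y)$, $(a\cdot x)y=a\cdot(xy)$. A relative averaging algebra of weight $1$ is a triple $(A,B,P)$ with $A$ an associative algebra (not necessarily unital), $B$ an associative $A$-bimodule and $P:B\to A$ linear with $P(x)P(y)=P(P(x)\cdot y)=P(x\cdot P(y))=P(xy)$ for all $x,y\in B$. A triassociative algebra is a vector space $D$ with three bilinear operations $\dashv,\vdash,\perp$ such that for all $x,y,z\in D$: $(x\dashv y)\dashv z=x\dashv(y\dashv z)=x\dashv(y\vdash z)=x\dashv(y\perp z)$; $(x\vdash y)\dashv z=x\vdash(y\dashv z)$; $(x\dashv y)\vdash z=(x\vdash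 y)\vdash z=(x\perp y)\vdash z=x\vdash(y\vdash z)$; $(x\perp y)\dashv z=x\perp(y\dashv z)$; $(x\dashv y)\perp z=x\perp(y\vdash z)$; $(x\vdash y)\perp z=x\vdash(y\perp z)$; $(x\perp y)\perp z=x\perp(y\perp z)$. *)

theory Defs
  imports "HOL-Algebra.Module"
begin

locale char_zero_field = field +
  assumes char_zero: "0 < (n::nat) \<Longrightarrow> [n] \<cdot> \<one> \<noteq> \<zero>"

locale vectorspace = K?: field K + module K V for K (structure) and V (structure)

definition linear_map ::
  "('k, 'm) ring_scheme \<Rightarrow> ('k, 'u, 'p) module_scheme \<Rightarrow> ('k, 'v, 'q) module_scheme \<Rightarrow> ('u \<Rightarrow> 'v) \<Rightarrow> bool"
  where "linear_map K U V f \<longleftrightarrow>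
    f \<in> carrier U \<rightarrow> carrier V \<and>
    (\<forall>x\<in>carrier U. \<forall>y\<in>carrier U. f (x \<oplus>\<^bsub>U\<^esub> y) = f x \<oplus>\<^bsub>V\<^esub> f y) \<and>
    (\<forall>c\<in>carrier K. \<forall>x\<in>carrier U. f (c \<odot>\<^bsub>U\<^esub> x) = c \<odot>\<^bsub>V\<^esub> f x)"

definition bilinear_map ::
  "('k, 'm) ring_scheme \<Rightarrow> ('k, 'u, 'p) module_scheme \<Rightarrow> ('k, 'v, 'q) module_scheme
    \<Rightarrow> ('k, 'w, 'r) module_scheme \<Rightarrow> ('u \<Rightarrow> 'v \<Rightarrow> 'w) \<Rightarrow> bool"
  where "bilinear_map K U V W f \<longleftrightarrow>
    (\<forall>v\<in>carrier V. linear_map K U W (\<lambda>u. f u v)) \<and>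
    (\<forall>u\<in>carrier U. linear_map K V W (f u))"

text \<open>
  The product of a not necessarily unital algebra is the \<^const>\<open>mult\<close> field of the
  module record; the \<^const>\<open>one\<close> field is not constrained.
\<close>

locale assoc_algebra = vectorspace K A for K (structure) and A (structure) +
  assumes mult_bilinear: "bilinear_map K A A A (\<otimes>\<^bsub>A\<^esub>)"
    and mult_assoc: "\<lbrakk>x \<in> carrier A; y \<in> carrier A; z \<in> carrier A\<rbrakk> \<Longrightarrow>
      (x \<otimes>\<^bsub>A\<^esub> y) \<otimes>\<^bsub>A\<^esub> z = x \<otimes>\<^bsub>A\<^esub> (y \<otimes>\<^bsub>A\<^esub> z)"

text \<open>
  Left action \<open>lact : A \<times> B \<rightarrow> B\<close> and right action \<open>ract : B \<times> A \<rightarrow> B\<close>. Linear maps out of a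
  tensor product are rendered as bilinear maps.
\<close>

locale assoc_bimodule =
  A: assoc_algebra K A + B: assoc_algebra K B
  for K (structure) and A (structure) and B (structure) +
  fixes lact :: "'b \<Rightarrow> 'd \<Rightarrow> 'd" (infixr \<open>\<rhd>\<close> 75)
    and ract :: "'d \<Rightarrow> 'b \<Rightarrow> 'd" (infixl \<open>\<lhd>\<close> 75)
  assumes lact_bilinear: "bilinear_map K A B B (\<rhd>)"
    and ract_bilinear: "bilinear_map K B A B (\<lhd>)"
    and lact_lact: "\<lbrakk>a \<in> carrier A; b \<in> carrier A; x \<in> carrier B\<rbrakk> \<Longrightarrow>
      (a \<otimes>\<^bsub>A\<^esub> b) \<rhd> x = a \<rhd> (b \<rhd> x)"
    and lact_ract: "\<lbrakk>a \<in> carrier A; b \<in> carrier A; x \<in> carrier B\<rbrakk> \<Longrightarrow>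
      (a \<rhd> x) \<lhd> b = a \<rhd> (x \<lhd> b)"
    and ract_ract: "\<lbrakk>a \<in> carrier A; b \<in> carrier A; x \<in> carrier B\<rbrakk> \<Longrightarrow>
      (x \<lhd> a) \<lhd> b = x \<lhd> (a \<otimes>\<^bsub>A\<^esub> b)"
    and mult_ract: "\<lbrakk>a \<in> carrier A; x \<in> carrier B; y \<in> carrier B\<rbrakk> \<Longrightarrow>
      (x \<otimes>\<^bsub>B\<^esub> y) \<lhd> a = x \<otimes>\<^bsub>B\<^esub> (y \<lhd> a)"
    and ract_mult: "\<lbrakk>a \<in> carrier A; x \<in> carrier B; y \<in> carrier B\<rbrakk> \<Longrightarrow>
      (x \<lhd> a) \<otimes>\<^bsub>B\<^esub> y = x \<otimes>\<^bsub>B\<^esub> (a \<rhd> y)"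
    and lact_mult: "\<lbrakk>a \<in> carrier A; x \<in> carrier B; y \<in> carrier B\<rbrakk> \<Longrightarrow>
      (a \<rhd> x) \<otimes>\<^bsub>B\<^esub> y = a \<rhd> (x \<otimes>\<^bsub>B\<^esub> y)"

locale relative_averaging_algebra_weight1 =
  assoc_bimodule K A B lact ract
  for K (structure) and A (structure) and B (structure)
    and lact (infixr \<open>\<rhd>\<close> 75) and ract (infixl \<open>\<lhd>\<close> 75) +
  fixes P
  assumes P_linear: "linear_map K B A P"
    and P_lact: "\<lbrakk>x \<in> carrier B; y \<in> carrier B\<rbrakk> \<Longrightarrow> P x \<otimes>\<^bsub>A\<^esub> P y = P (P x \<rhd> y)"
    and P_ract: "\<lbrakk>x \<in> carrier B; y \<in> carrier B\<rbrakk> \<Longrightarrow> P x \<otimes>\<^bsub>A\<^esub> P y = P (x \<lhd> P y)"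
    and P_mult: "\<lbrakk>x \<in> carrier B; y \<in> carrier B\<rbrakk> \<Longrightarrow> P x \<otimes>\<^bsub>A\<^esub> P y = P (x \<otimes>\<^bsub>B\<^esub> y)"

text \<open>
  Only the vector space part of the record \<open>D\<close> is used; the three operations are separate
  parameters (\<open>\<star>\<close> is the operation usually written with the bottom sign), and the
  \<^const>\<open>mult\<close> and \<^const>\<open>one\<close> fields of \<open>D\<close> are not constrained.
\<close>

locale triassociative_algebra = vectorspace K D for K (structure) and D (structure) +
  fixes ltri :: "'b \<Rightarrow> 'b \<Rightarrow> 'b" (infixl \<open>\<stileturn>\<close> 70)
    and rtri :: "'b \<Rightarrow> 'b \<Rightarrow> 'b" (infixl \<open>\<turnstile>\<close> 70)
    and mtri :: "'b \<Rightarrow> 'b \<Rightarrow> 'b" (infixl \<open>\<star>\<close> 70)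
  assumes ltri_bilinear: "bilinear_map K D D D (\<stileturn>)"
    and rtri_bilinear: "bilinear_map K D D D (\<turnstile>)"
    and mtri_bilinear: "bilinear_map K D D D (\<star>)"
    and ltri_ltri: "\<lbrakk>x \<in> carrier D; y \<in> carrier D; z \<in> carrier D\<rbrakk> \<Longrightarrow>
      (x \<stileturn> y) \<stileturn> z = x \<stileturn> (y \<stileturn> z)"
    and ltri_rtri: "\<lbrakk>x \<in> carrier D; y \<in> carrier D; z \<in> carrier D\<rbrakk> \<Longrightarrow>
      x \<stileturn> (y \<stileturn> z) = x \<stileturn> (y \<turnstile> z)"
    and ltri_mtri: "\<lbrakk>x \<in> carrier D; y \<in> carrier D; z \<in> carrier D\<rbrakk> \<Longrightarrow>
      x \<stileturn> (y \<turnstile> z) = x \<stileturn> (y \<star> z)"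
    and rtri_ltri: "\<lbrakk>x \<in> carrier D; y \<in> carrier D; z \<in> carrier D\<rbrakk> \<Longrightarrow>
      (x \<turnstile> y) \<stileturn> z = x \<turnstile> (y \<stileturn> z)"
    and ltri_then_rtri: "\<lbrakk>x \<in> carrier D; y \<in> carrier D; z \<in> carrier D\<rbrakk> \<Longrightarrow>
      (x \<stileturn> y) \<turnstile> z = (x \<turnstile> y) \<turnstile> z"
    and rtri_then_rtri: "\<lbrakk>x \<in> carrier D; y \<in> carrier D; z \<in> carrier D\<rbrakk> \<Longrightarrow>
      (x \<turnstile> y) \<turnstile> z = (x \<star> y) \<turnstile> z"
    and mtri_then_rtri: "\<lbrakk>x \<in> carrier D; y \<in> carrier D; z \<in> carrier D\<rbrakk> \<Longrightarrow>
      (x \<star> y) \<turnstile> z = x \<turnstile> (y \<turnstile> z)"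
    and mtri_ltri: "\<lbrakk>x \<in> carrier D; y \<in> carrier D; z \<in> carrier D\<rbrakk> \<Longrightarrow>
      (x \<star> y) \<stileturn> z = x \<star> (y \<stileturn> z)"
    and ltri_then_mtri: "\<lbrakk>x \<in> carrier D; y \<in> carrier D; z \<in> carrier D\<rbrakk> \<Longrightarrow>
      (x \<stileturn> y) \<star> z = x \<star> (y \<turnstile> z)"
    and rtri_then_mtri: "\<lbrakk>x \<in> carrier D; y \<in> carrier D; z \<in> carrier D\<rbrakk> \<Longrightarrow>
      (x \<turnstile> y) \<star> z = x \<turnstile> (y \<star> z)"
    and mtri_mtri: "\<lbrakk>x \<in> carrier D; y \<in> carrier D; z \<in> carrier D\<rbrakk> \<Longrightarrow>
      (x \<star> y) \<star> z = x \<star> (y \<star> z)"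

definition same_vectorspace ::
  "('k, 'm) ring_scheme \<Rightarrow> ('k, 'v, 'p) module_scheme \<Rightarrow> ('k, 'v, 'q) module_scheme \<Rightarrow> bool"
  where "same_vectorspace K U V \<longleftrightarrow>
    carrier U = carrier V \<and> \<zero>\<^bsub>U\<^esub> = \<zero>\<^bsub>V\<^esub> \<and>
    (\<forall>x\<in>carrier U. \<forall>y\<in>carrier U. x \<oplus>\<^bsub>U\<^esub> y = x \<oplus>\<^bsub>V\<^esub> y) \<and>
    (\<forall>c\<in>carrier K. \<forall>x\<in>carrier U. c \<odot>\<^bsub>U\<^esub> x = c \<odot>\<^bsub>V\<^esub> x)"

end

theory Submission
  imports Defs
begin

text \<open>
  Let \<open>A\<close> be the quotient of \<open>D\<close> that identifies \<open>x\<close> and \<open>y\<close> whenever \<open>z \<stileturn> x = z \<stileturn> y\<close> and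
  \<open>x \<turnstile> z = y \<turnstile> z\<close> for all \<open>z\<close>, and let \<open>P\<close> be the quotient map. This is the coarsest
  relation for which \<open>x \<cdot> P y = x \<stileturn> y\<close> and \<open>P x \<cdot> y = x \<turnstile> y\<close> are well defined, and the
  triassociative axioms say that it is a congruence for which \<open>x \<stileturn> y\<close>, \<open>x \<turnstile> y\<close> and \<open>x \<star> y\<close>
  are all congruent; their common class is the product of \<open>A\<close>.
\<close>

lemma bilinear_mapD:
  assumes "bilinear_map K U V W f"
  shows "\<lbrakk>u \<in> carrier U; v \<in> carrier V\<rbrakk> \<Longrightarrow> f u v \<in> carrier W"
    and "\<lbrakk>u \<in> carrier U; u' \<in> carrier U; v \<in> carrier V\<rbrakk> \<Longrightarrow>
      f (u \<oplus>\<^bsub>U\<^esub> u') v = f u v \<oplus>\<^bsub>W\<^esub> f u' v"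
    and "\<lbrakk>u \<in> carrier U; v \<in> carrier V; v' \<in> carrier V\<rbrakk> \<Longrightarrow>
      f u (v \<oplus>\<^bsub>V\<^esub> v') = f u v \<oplus>\<^bsub>W\<^esub> f u v'"
    and "\<lbrakk>c \<in> carrier K; u \<in> carrier U; v \<in> carrier V\<rbrakk> \<Longrightarrow> f (c \<odot>\<^bsub>U\<^esub> u) v = c \<odot>\<^bsub>W\<^esub> f u v"
    and "\<lbrakk>c \<in> carrier K; u \<in> carrier U; v \<in> carrier V\<rbrakk> \<Longrightarrow> f u (c \<odot>\<^bsub>V\<^esub> v) = c \<odot>\<^bsub>W\<^esub> f u v"
  using assms by (auto simp: bilinear_map_def linear_map_def)

lemma bilinear_mapI:
  assumes "\<And>u v. \<lbrakk>u \<in> carrier U; v \<in> carrier V\<rbrakk> \<Longrightarrow> f u v \<in> carrier W"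
    and "\<And>u u' v. \<lbrakk>u \<in> carrier U; u' \<in> carrier U; v \<in> carrier V\<rbrakk> \<Longrightarrow>
      f (u \<oplus>\<^bsub>U\<^esub> u') v = f u v \<oplus>\<^bsub>W\<^esub> f u' v"
    and "\<And>u v v'. \<lbrakk>u \<in> carrier U; v \<in> carrier V; v' \<in> carrier V\<rbrakk> \<Longrightarrow>
      f u (v \<oplus>\<^bsub>V\<^esub> v') = f u v \<oplus>\<^bsub>W\<^esub> f u v'"
    and "\<And>c u v. \<lbrakk>c \<in> carrier K; u \<in> carrier U; v \<in> carrier V\<rbrakk> \<Longrightarrow>
      f (c \<odot>\<^bsub>U\<^esub> u) v = c \<odot>\<^bsub>W\<^esub> f u v"
    and "\<And>c u v. \<lbrakk>c \<in> carrier K; u \<in> carrier U; v \<in> carrier V\<rbrakk> \<Longrightarrow>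
      f u (c \<odot>\<^bsub>V\<^esub> v) = c \<odot>\<^bsub>W\<^esub> f u v"
  shows "bilinear_map K U V W f"
  using assms by (auto simp: bilinear_map_def linear_map_def)

context triassociative_algebra
begin

lemmas ltri_simps = bilinear_mapD[OF ltri_bilinear]
lemmas rtri_simps = bilinear_mapD[OF rtri_bilinear]
lemmas mtri_simps = bilinear_mapD[OF mtri_bilinear]

definition act_class :: "'b \<Rightarrow> 'b set"
  where "act_class x = {y \<in> carrier D. \<forall>z\<in>carrier D. z \<stileturn> y = z \<stileturn> x \<and> y \<turnstile> z = x \<turnstile> z}"

text \<open>A choice of representative makes the actions of the quotient on \<open>D\<close> total
  functions on sets. The choice is harmless as long as the representative occurs only as right
  argument of \<stileturn> or left argument of \<turnstile>.\<close>

definition act_rep :: "'b set \<Rightarrow> 'b"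
  where "act_rep S = (SOME x. x \<in> S)"

lemma act_class_eqI:
  assumes "\<And>z. z \<in> carrier D \<Longrightarrow> z \<stileturn> x = z \<stileturn> y" "\<And>z. z \<in> carrier D \<Longrightarrow> x \<turnstile> z = y \<turnstile> z"
  shows "act_class x = act_class y"
  using assms by (auto simp: act_class_def)

lemma act_rep:
  assumes "x \<in> carrier D"
  shows act_rep_closed: "act_rep (act_class x) \<in> carrier D"
    and ltri_act_rep: "z \<in> carrier D \<Longrightarrow> z \<stileturn> act_rep (act_class x) = z \<stileturn> x"
    and act_rep_rtri: "z \<in> carrier D \<Longrightarrow> act_rep (act_class x) \<turnstile> z = x \<turnstile> z"
proof -
  have "x \<in> act_class x"
    using assms by (simp add: act_class_def)
  then have "act_rep (act_class x) \<in> act_class x"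
    unfolding act_rep_def by (rule someI)
  then show "act_rep (act_class x) \<in> carrier D"
    and "z \<in> carrier D \<Longrightarrow> z \<stileturn> act_rep (act_class x) = z \<stileturn> x"
    and "z \<in> carrier D \<Longrightarrow> act_rep (act_class x) \<turnstile> z = x \<turnstile> z"
    by (auto simp: act_class_def)
qed

definition act_quotient :: "('a, 'b set) module"
  where "act_quotient = \<lparr>carrier = act_class ` carrier D,
    mult = (\<lambda>S T. act_class (act_rep S \<stileturn> act_rep T)),
    one = undefined,
    zero = act_class \<zero>\<^bsub>D\<^esub>,
    add = (\<lambda>S T. act_class (act_rep S \<oplus>\<^bsub>D\<^esub> act_rep T)),
    smult = (\<lambda>c S. act_class (c \<odot>\<^bsub>D\<^esub> act_rep S))\<rparr>"

lemma act_quotient_carrier: "carrier act_quotient = act_class ` carrier D"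
  and act_quotient_zero: "\<zero>\<^bsub>act_quotient\<^esub> = act_class \<zero>\<^bsub>D\<^esub>"
  by (simp_all add: act_quotient_def)

text \<open>Independence of representatives: \<stileturn> is additive in its right argument and
  \<turnstile> in its left one, so the relation respects sums.\<close>

lemma act_quotient_add:
  assumes "x \<in> carrier D" "y \<in> carrier D"
  shows "act_class x \<oplus>\<^bsub>act_quotient\<^esub> act_class y = act_class (x \<oplus>\<^bsub>D\<^esub> y)"
  using assms unfolding act_quotient_def
  by (auto intro!: act_class_eqI simp: act_rep ltri_simps rtri_simps)

lemma act_quotient_smult:
  assumes "c \<in> carrier K" "x \<in> carrier D"
  shows "c \<odot>\<^bsub>act_quotient\<^esub> act_class x = act_class (c \<odot>\<^bsub>D\<^esub> x)"
  using assms unfolding act_quotient_def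
  by (auto intro!: act_class_eqI simp: act_rep ltri_simps rtri_simps)

text \<open>This chain of axioms says that x \<stileturn> y acts from the left as the action of y
  followed by that of x. It gives both the well-definedness of the quotient product and the left
  module law.\<close>

lemma ltri_rtri_assoc:
  assumes "x \<in> carrier D" "y \<in> carrier D" "z \<in> carrier D"
  shows "(x \<stileturn> y) \<turnstile> z = x \<turnstile> (y \<turnstile> z)"
  using assms by (simp add: ltri_then_rtri rtri_then_rtri mtri_then_rtri)

text \<open>Both actions of x \<stileturn> y are composites of those of x and y. Using
  \<open>ltri_ltri\<close> from right to left turns z \<stileturn> (x \<stileturn> y) into (z
  \<stileturn> x) \<stileturn> y, where each factor is a right argument of \<stileturn> and may be
  exchanged for its representative.\<close>

lemma act_quotient_mult:
  assumes "x \<in> carrier D" "y \<in> carrier D"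
  shows "act_class x \<otimes>\<^bsub>act_quotient\<^esub> act_class y = act_class (x \<stileturn> y)"
  using assms unfolding act_quotient_def
  by (auto intro!: act_class_eqI
      simp: act_rep ltri_simps rtri_simps ltri_rtri_assoc simp flip: ltri_ltri)

lemma act_class_rtri:
  assumes "x \<in> carrier D" "y \<in> carrier D"
  shows "act_class (x \<turnstile> y) = act_class (x \<stileturn> y)"
  using assms by (auto intro!: act_class_eqI simp: ltri_rtri ltri_then_rtri)

lemma act_class_mtri:
  assumes "x \<in> carrier D" "y \<in> carrier D"
  shows "act_class (x \<star> y) = act_class (x \<stileturn> y)"
  using assms
  by (auto intro!: act_class_eqI simp: ltri_rtri ltri_mtri ltri_then_rtri rtri_then_rtri)

lemmas act_quotient_simps = act_quotient_carrier act_quotient_zero act_quotient_add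
  act_quotient_smult act_quotient_mult

lemma act_quotient_abelian_group: "abelian_group act_quotient"
proof (rule abelian_groupI)
  fix S assume "S \<in> carrier act_quotient"
  then obtain x where x: "x \<in> carrier D" "S = act_class x"
    by (auto simp: act_quotient_carrier)
  then have "act_class (\<ominus>\<^bsub>D\<^esub> x) \<in> carrier act_quotient"
    "act_class (\<ominus>\<^bsub>D\<^esub> x) \<oplus>\<^bsub>act_quotient\<^esub> S = \<zero>\<^bsub>act_quotient\<^esub>"
    by (simp_all add: act_quotient_simps M.l_neg)
  then show "\<exists>T\<in>carrier act_quotient. T \<oplus>\<^bsub>act_quotient\<^esub> S = \<zero>\<^bsub>act_quotient\<^esub>"
    by blast
qed (auto simp: act_quotient_simps M.a_ac)

lemma act_quotient_vectorspace: "vectorspace K act_quotient"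
proof (rule vectorspace.intro)
  show "field K" by (rule K.field_axioms)
  show "module K act_quotient"
    by (rule moduleI[OF K.is_cring act_quotient_abelian_group])
      (auto simp: act_quotient_simps smult_l_distr smult_r_distr smult_assoc1)
qed

lemma act_quotient_assoc_algebra: "assoc_algebra K act_quotient"
proof (rule assoc_algebra.intro[OF act_quotient_vectorspace], unfold_locales)
  show "bilinear_map K act_quotient act_quotient act_quotient (\<otimes>\<^bsub>act_quotient\<^esub>)"
    by (rule bilinear_mapI) (auto simp: act_quotient_simps ltri_simps)
qed (auto simp: act_quotient_simps ltri_simps ltri_ltri)

text \<open>This is the algebra B. The update touches only the product, so the module laws are those
  of \<open>D\<close>, proved again for the new record.\<close>

lemma mtri_algebra: "assoc_algebra K (D\<lparr>mult := (\<star>)\<rparr>)"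
proof -
  have "abelian_group (D\<lparr>mult := (\<star>)\<rparr>)"
    by (rule abelian_groupI)
      (auto simp: M.a_assoc M.l_neg intro: M.a_comm bexI[of _ "\<ominus>\<^bsub>D\<^esub> _"])
  then have "module K (D\<lparr>mult := (\<star>)\<rparr>)"
    by (rule moduleI[OF K.is_cring])
      (auto simp: smult_l_distr smult_r_distr smult_assoc1)
  then have "vectorspace K (D\<lparr>mult := (\<star>)\<rparr>)"
    by (rule vectorspace.intro[OF K.field_axioms])
  then show ?thesis
    by (rule assoc_algebra.intro, unfold_locales)
      (auto intro!: bilinear_mapI simp: mtri_simps mtri_mtri)
qed

text \<open>Once representatives are eliminated, the six bimodule laws, in the order of the locale,
  become \<open>ltri_rtri_assoc\<close>, \<open>rtri_ltri\<close>, \<open>ltri_ltri\<close>,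
  \<open>mtri_ltri\<close>, \<open>ltri_then_mtri\<close> and \<open>rtri_then_mtri\<close>.\<close>

lemma act_quotient_bimodule:
  "assoc_bimodule K act_quotient (D\<lparr>mult := (\<star>)\<rparr>) (\<lambda>S x. act_rep S \<turnstile> x) (\<lambda>x S. x \<stileturn> act_rep S)"
proof (rule assoc_bimodule.intro[OF act_quotient_assoc_algebra mtri_algebra], unfold_locales)
  show "bilinear_map K act_quotient (D\<lparr>mult := (\<star>)\<rparr>) (D\<lparr>mult := (\<star>)\<rparr>) (\<lambda>S x. act_rep S \<turnstile> x)"
    by (rule bilinear_mapI) (auto simp: act_quotient_simps act_rep rtri_simps)
  show "bilinear_map K (D\<lparr>mult := (\<star>)\<rparr>) act_quotient (D\<lparr>mult := (\<star>)\<rparr>) (\<lambda>x S. x \<stileturn> act_rep S)"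
    by (rule bilinear_mapI) (auto simp: act_quotient_simps act_rep ltri_simps)
qed (auto simp: act_quotient_simps act_rep ltri_simps rtri_simps mtri_simps ltri_rtri_assoc
    ltri_ltri rtri_ltri mtri_ltri ltri_then_mtri rtri_then_mtri)

text \<open>The product of the classes of x and y is the class of x \<stileturn> y, which settles
  \<open>P_ract\<close>. The other two averaging identities are \<open>act_class_rtri\<close> and
  \<open>act_class_mtri\<close>.\<close>

lemma act_quotient_relative_averaging:
  "relative_averaging_algebra_weight1 K act_quotient (D\<lparr>mult := (\<star>)\<rparr>)
    (\<lambda>S x. act_rep S \<turnstile> x) (\<lambda>x S. x \<stileturn> act_rep S) act_class"
  by (rule relative_averaging_algebra_weight1.intro[OF act_quotient_bimodule], unfold_locales)
    (auto simp: linear_map_def act_quotient_simps act_rep act_class_rtri act_class_mtri)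

end

theorem mainTheorem10:
  fixes K :: "('k, 'm) ring_scheme"
    and D :: "('k, 'd) module"
    and ltri rtri mtri :: "'d \<Rightarrow> 'd \<Rightarrow> 'd"
  assumes "char_zero_field K"
    and "triassociative_algebra K D ltri rtri mtri"
  shows "\<exists>(A :: ('k, 'd set) module) (B :: ('k, 'd) module)
      (lact :: 'd set \<Rightarrow> 'd \<Rightarrow> 'd) (ract :: 'd \<Rightarrow> 'd set \<Rightarrow> 'd) (P :: 'd \<Rightarrow> 'd set).
    relative_averaging_algebra_weight1 K A B lact ract P \<and>
    same_vectorspace K B D \<and>
    (\<forall>x\<in>carrier D. \<forall>y\<in>carrier D.
      ltri x y = ract x (P y) \<and>
      rtri x y = lact (P x) y \<and>
      mtri x y = x \<otimes>\<^bsub>B\<^esub> y)"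
proof -
  interpret triassociative_algebra K D ltri rtri mtri by (rule assms(2))
  have "same_vectorspace K (D\<lparr>mult := mtri\<rparr>) D"
    by (simp add: same_vectorspace_def)
  \<comment> \<open>With \<open>P\<close> = \<open>act_class\<close>, each action goes through a
    representative of P y or P x, which acts exactly as y or x does.\<close>
  moreover have "\<forall>x\<in>carrier D. \<forall>y\<in>carrier D.
      ltri x y = ltri x (act_rep (act_class y)) \<and>
      rtri x y = rtri (act_rep (act_class x)) y \<and>
      mtri x y = x \<otimes>\<^bsub>D\<lparr>mult := mtri\<rparr>\<^esub> y"
    by (simp add: act_rep)
  ultimately show ?thesis
    using act_quotient_relative_averaging by blast
qed

end
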